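(* The map $\Phi$ induces a bijection from $\mathrm{MotzPF}_n/\!\sim$ to the set $\mathrm{Motz}_n$ of Motzkin paths of length $n$.
   Context: $[n]=\{1,\dots,n\}$. A parking function of length $n$ is $p\in[n]^n$ whose non-decreasing rearrangement $a_1\le\dots\le a_n$ satisfies $a_i\le i$ for all $i$. $\mathrm{MotzPF}_n$ is the set of parking functions $p$ of length $n$ such that $|\{i:p_i=j\}|\le 2$ for every $j\in[n]$. For $p,p'\in\mathrm{MotzPF}_n$, $p\sim p'$ if $p'$ is obtained by permuting the entries of $p$. For $p\in[n]^n$, $\Phi(p)=\phi_1\cdots\phi_n$ is the lattice path with steps $\phi_j=U=(1,1)$ if $|\{i:p_i=j\}|\ge2$, $\phi_j=H=(1,0)$ if $|\{i:p_i=j\}|=1$, $\phi_j=D=(1,-1)$ if $|\{i:p_i=j\}|=0$; it is constant on $\sim$-classes. $\mathrm{Motz}_n$ is the set of lattice paths from $(0,0)$ to $(n,0)$ with steps $U,H,D$ never going below the $x$-axis. *)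

theory Defs
  imports Main "HOL-Library.Product_Plus" "HOL-Combinatorics.Permutations"
begin

text \<open>A tuple \<open>(p\<^sub>1, \<dots>, p\<^sub>n)\<close> is a list of length \<open>n\<close>; the entry \<open>p\<^sub>i\<close> is \<open>p ! (i - 1)\<close>.\<close>

definition tuples :: "nat \<Rightarrow> nat list set" where
  "tuples n = {p. length p = n \<and> set p \<subseteq> {1..n}}"

definition parking_functions :: "nat \<Rightarrow> nat list set" where
  "parking_functions n = {p \<in> tuples n. \<forall>i\<in>{1..n}. sort p ! (i - 1) \<le> i}"

definition mult :: "nat list \<Rightarrow> nat \<Rightarrow> nat" where
  "mult p j = card {i \<in> {..<length p}. p ! i = j}"

definition MotzPF :: "nat \<Rightarrow> nat list set" where
  "MotzPF n = {p \<in> parking_functions n. \<forall>j\<in>{1..n}. mult p j \<le> 2}"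

definition perm_rel :: "nat \<Rightarrow> (nat list \<times> nat list) set" where
  "perm_rel n = {(p, p'). p \<in> MotzPF n \<and> p' \<in> MotzPF n \<and>
     (\<exists>\<sigma>. \<sigma> permutes {..<n} \<and> p' = permute_list \<sigma> p)}"

datatype step = U | H | D

fun step_vec :: "step \<Rightarrow> int \<times> int" where
  "step_vec U = (1, 1)"
| "step_vec H = (1, 0)"
| "step_vec D = (1, -1)"

text \<open>The lattice point reached from the origin after the steps of \<open>w\<close>.\<close>

definition endpoint :: "step list \<Rightarrow> int \<times> int" where
  "endpoint w = sum_list (map step_vec w)"

definition Motz :: "nat \<Rightarrow> step list set" where
  "Motz n = {w. endpoint w = (int n, 0) \<and> (\<forall>k\<le>length w. 0 \<le> snd (endpoint (take k w)))}"

definition Phi :: "nat \<Rightarrow> nat list \<Rightarrow> step list" where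
  "Phi n p = map (\<lambda>j. if mult p j \<ge> 2 then U else if mult p j = 1 then H else D) [1..<n+1]"

text \<open>The map on equivalence classes induced by \<open>f\<close>: on a class \<open>C\<close> on which \<open>f\<close> is constant,
  it returns the unique element of \<open>f ` C\<close>.\<close>

definition induced :: "('a \<Rightarrow> 'b) \<Rightarrow> 'a set \<Rightarrow> 'b" where
  "induced f C = the_elem (f ` C)"

lemma perm_rel_iff_mset:
  "(p, p') \<in> perm_rel n \<longleftrightarrow> p \<in> MotzPF n \<and> p' \<in> MotzPF n \<and> mset p = mset p'"
proof -
  have "(\<exists>\<sigma>. \<sigma> permutes {..<n} \<and> p' = permute_list \<sigma> p) \<longleftrightarrow> mset p = mset p'"
    if "p \<in> MotzPF n" "p' \<in> MotzPF n"
  proof -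
    have len: "length p = n" "length p' = n"
      using that by (auto simp: MotzPF_def parking_functions_def tuples_def)
    show ?thesis
    proof
      assume "\<exists>\<sigma>. \<sigma> permutes {..<n} \<and> p' = permute_list \<sigma> p"
      then show "mset p = mset p'" using len by auto
    next
      assume "mset p = mset p'"
      then show "\<exists>\<sigma>. \<sigma> permutes {..<n} \<and> p' = permute_list \<sigma> p"
        using len by (metis mset_eq_permutation)
    qed
  qed
  then show ?thesis by (auto simp: perm_rel_def)
qed

lemma equiv_perm_rel: "equiv (MotzPF n) (perm_rel n)"
  by (rule equivI) (auto simp: refl_on_def sym_def trans_def perm_rel_iff_mset)

end

theory Submission
  imports Defs
begin

text \<open>
  A step records the multiplicity \<open>2, 1, 0\<close> of a value as \<open>U, H, D\<close>, that is, as its height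
  change plus one. Hence the height of \<open>\<Phi>(p)\<close> after \<open>k\<close> steps is the number of entries of \<open>p\<close>
  that are at most \<open>k\<close>, minus \<open>k\<close>; that all these heights are nonnegative is precisely the
  parking condition. The multiplicities determine the entries up to order, and every word in
  \<open>U, H, D\<close> arises from some choice of multiplicities.
\<close>

lemma induced_class:
  assumes "equiv A r" "f respects r" "x \<in> A"
  shows "induced f (r `` {x}) = f x"
proof -
  have "f ` (r `` {x}) = {f x}"
    using assms equiv_class_self[OF assms(1,3)] by (force simp: congruent_def)
  then show ?thesis by (simp add: induced_def)
qed

lemma bij_betw_induced:
  assumes equiv: "equiv A r" and respects: "f respects r"
    and separates: "\<And>x y. \<lbrakk>x \<in> A; y \<in> A; f x = f y\<rbrakk> \<Longrightarrow> (x, y) \<in> r"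
  shows "bij_betw (induced f) (A // r) (f ` A)"
proof (rule bij_betw_imageI)
  note [simp] = induced_class[OF equiv respects]
  show "inj_on (induced f) (A // r)"
  proof (rule inj_onI)
    fix X Y
    assume "X \<in> A // r" "Y \<in> A // r" and eq: "induced f X = induced f Y"
    then obtain x y where "x \<in> A" "X = r `` {x}" "y \<in> A" "Y = r `` {y}"
      by (meson quotientE)
    with eq show "X = Y"
      using separates equiv_class_eq[OF equiv] by simp
  qed
  show "induced f ` (A // r) = f ` A"
    by (simp add: quotient_def UNION_singleton_eq_range image_image)
qed

lemma sorted_nth_le_iff:
  fixes xs :: "'a::linorder list"
  assumes "sorted xs" "k < length xs"
  shows "xs ! k \<le> m \<longleftrightarrow> k < length (filter (\<lambda>x. x \<le> m) xs)"
  using assms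
proof (induction xs arbitrary: k)
  case (Cons x xs)
  show ?case
  proof (cases "x \<le> m")
    case True
    then show ?thesis using Cons by (cases k) auto
  next
    case False
    then have "\<forall>y\<in>set (x # xs). \<not> y \<le> m" using Cons.prems(1) by auto
    then have "filter (\<lambda>y. y \<le> m) (x # xs) = []" and "\<not> (x # xs) ! k \<le> m"
      using Cons.prems(2) by (metis filter_False, metis nth_mem)
    then show ?thesis by simp
  qed
qed simp

lemma sum_count_list:
  assumes "finite A"
  shows "sum (count_list xs) A = length (filter (\<lambda>x. x \<in> A) xs)"
proof (induction xs)
  case (Cons x xs)
  have "sum (count_list (x # xs)) A = (\<Sum>y\<in>A. count_list xs y + (if x = y then 1 else 0))"
    by (rule sum.cong) auto
  then show ?case
    using assms Cons.IH by (simp add: sum.distrib)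
qed simp

lemma mset_eq_if_count_list_eq_on:
  assumes "set xs \<subseteq> A" "set ys \<subseteq> A" "\<And>x. x \<in> A \<Longrightarrow> count_list xs x = count_list ys x"
  shows "mset xs = mset ys"
proof (rule multiset_eqI)
  fix x
  show "count (mset xs) x = count (mset ys) x"
  proof (cases "x \<in> A")
    case False
    then have "x \<notin> set xs" "x \<notin> set ys"
      using assms(1,2) by auto
    then show ?thesis by (simp add: count_mset)
  qed (simp add: assms(3) count_mset)
qed

lemma in_set_concat_map2_replicateD: "x \<in> set (concat (map2 replicate ms xs)) \<Longrightarrow> x \<in> set xs"
  by (auto dest: set_zip_rightD split: if_splits)

lemma map_count_list_concat_map2_replicate:
  assumes "length ms = length xs" "distinct xs"
  shows "map (count_list (concat (map2 replicate ms xs))) xs = ms"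
  using assms
proof (induction ms xs rule: list_induct2)
  case (Cons m ms x xs)
  let ?ys = "concat (map2 replicate ms xs)"
  have count_replicate: "count_list (replicate m x) y = (if y = x then m else 0)" for y
    by (simp add: count_list_eq_length_filter)
  have "x \<notin> set ?ys"
    using Cons.prems by (metis distinct.simps(2) in_set_concat_map2_replicateD)
  then have "count_list (replicate m x @ ?ys) x = m"
    by (simp only: count_list_append count_replicate count_notin) simp
  moreover have "map (count_list (replicate m x @ ?ys)) xs = ms"
  proof -
    have "map (count_list (replicate m x @ ?ys)) xs = map (count_list ?ys) xs"
      using Cons.prems by (intro map_cong refl) (auto simp: count_replicate)
    also have "\<dots> = ms" using Cons by simp
    finally show ?thesis .
  qed
  ultimately show ?case
    by (simp del: count_list_append)
qed simp

fun step_mult :: "step \<Rightarrow> nat" where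
  "step_mult U = 2"
| "step_mult H = 1"
| "step_mult D = 0"

lemma inj_step_mult: "inj step_mult"
proof (rule injI)
  fix s t
  show "step_mult s = step_mult t \<Longrightarrow> s = t"
    by (cases s; cases t) auto
qed

lemma step_mult_le_2: "step_mult s \<le> 2"
  by (cases s) auto

lemma endpoint_eq:
  "endpoint w = (int (length w), int (sum_list (map step_mult w)) - int (length w))"
proof (induction w)
  case (Cons s w)
  then show ?case by (cases s) (auto simp: endpoint_def)
qed (simp add: endpoint_def zero_prod_def)

lemma Motz_iff:
  "w \<in> Motz n \<longleftrightarrow> length w = n \<and> sum_list (map step_mult w) = n
    \<and> (\<forall>k\<le>n. k \<le> sum_list (take k (map step_mult w)))"
  by (auto simp: Motz_def endpoint_eq take_map)

lemma mult_eq_count_list: "mult = count_list"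
  by (simp add: fun_eq_iff mult_def count_list_eq_length_filter length_filter_conv_card
      lessThan_def eq_commute)

lemma Phi_respects_perm_rel: "Phi n respects perm_rel n"
  by (auto simp: congruent_def perm_rel_iff_mset Phi_def mult_eq_count_list simp flip: count_mset)

lemma map_step_mult_Phi:
  assumes "\<forall>j\<in>{1..n}. mult p j \<le> 2"
  shows "map step_mult (Phi n p) = map (mult p) [1..<n+1]"
  using assms by (auto simp: Phi_def simp del: upt_Suc intro: le_antisym)

lemma sum_list_take_mult:
  assumes "p \<in> tuples n" "k \<le> n"
  shows "sum_list (take k (map (mult p) [1..<n+1])) = length (filter (\<lambda>x. x \<le> k) p)"
proof -
  have "sum_list (take k (map (mult p) [1..<n+1])) = sum (mult p) {1..k}"
    using assms(2) by (simp add: take_map take_upt interv_sum_list_conv_sum_set_nat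
        atLeastLessThanSuc_atLeastAtMost del: upt_Suc)
  also have "\<dots> = length (filter (\<lambda>x. x \<in> {1..k}) p)"
    by (simp only: mult_eq_count_list sum_count_list finite_atLeastAtMost)
  also have "filter (\<lambda>x. x \<in> {1..k}) p = filter (\<lambda>x. x \<le> k) p"
    using assms(1) by (intro filter_cong) (auto simp: tuples_def)
  finally show ?thesis .
qed

lemma parking_functions_iff:
  assumes "p \<in> tuples n"
  shows "p \<in> parking_functions n \<longleftrightarrow> (\<forall>k\<le>n. k \<le> length (filter (\<lambda>x. x \<le> k) p))"
proof -
  have "sort p ! (k - 1) \<le> k \<longleftrightarrow> k \<le> length (filter (\<lambda>x. x \<le> k) p)" if "k \<in> {1..n}" for k
  proof -
    have "k - 1 < length (sort p)"
      using that assms by (auto simp: tuples_def)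
    then have "sort p ! (k - 1) \<le> k \<longleftrightarrow> k - 1 < length (filter (\<lambda>x. x \<le> k) p)"
      by (simp add: sorted_nth_le_iff filter_sort)
    then show ?thesis using that by auto
  qed
  then have "p \<in> parking_functions n \<longleftrightarrow> (\<forall>k\<in>{1..n}. k \<le> length (filter (\<lambda>x. x \<le> k) p))"
    using assms by (simp add: parking_functions_def)
  also have "\<dots> \<longleftrightarrow> (\<forall>k\<le>n. k \<le> length (filter (\<lambda>x. x \<le> k) p))"
    by (metis atLeastAtMost_iff le0 less_one not_le)
  finally show ?thesis .
qed

lemma Phi_in_Motz_iff:
  assumes tuple: "p \<in> tuples n" and "\<forall>j\<in>{1..n}. mult p j \<le> 2"
  shows "Phi n p \<in> Motz n \<longleftrightarrow> p \<in> parking_functions n"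
proof -
  note mults = map_step_mult_Phi[OF assms(2)]
  have "filter (\<lambda>x. x \<le> n) p = p" "length p = n"
    using tuple by (auto simp: tuples_def filter_id_conv)
  then have "sum_list (map step_mult (Phi n p)) = n"
    using sum_list_take_mult[OF tuple, of n] by (simp add: mults del: upt_Suc)
  moreover have "length (Phi n p) = n"
    by (simp add: Phi_def)
  ultimately have "Phi n p \<in> Motz n \<longleftrightarrow> (\<forall>k\<le>n. k \<le> length (filter (\<lambda>x. x \<le> k) p))"
    using sum_list_take_mult[OF tuple] by (simp add: Motz_iff mults del: upt_Suc)
  then show ?thesis
    using tuple by (simp add: parking_functions_iff)
qed

lemma MotzPF_iff:
  "p \<in> MotzPF n \<longleftrightarrow> p \<in> tuples n \<and> (\<forall>j\<in>{1..n}. mult p j \<le> 2) \<and> Phi n p \<in> Motz n"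
  by (auto simp: MotzPF_def Phi_in_Motz_iff parking_functions_def)

lemma mset_eq_if_Phi_eq:
  assumes "p \<in> MotzPF n" "q \<in> MotzPF n" "Phi n p = Phi n q"
  shows "mset p = mset q"
proof (rule mset_eq_if_count_list_eq_on)
  show "set p \<subseteq> {1..n}" "set q \<subseteq> {1..n}"
    using assms(1,2) by (auto simp: MotzPF_iff tuples_def)
  have "map (mult r) [1..<n+1] = map step_mult (Phi n r)" if "r \<in> MotzPF n" for r
    using that by (intro map_step_mult_Phi[symmetric]) (simp add: MotzPF_iff)
  then have "map (mult p) [1..<n+1] = map (mult q) [1..<n+1]"
    using assms by simp
  then show "count_list p j = count_list q j" if "j \<in> {1..n}" for j
    using that by (simp add: mult_eq_count_list del: upt_Suc)
qed

definition list_of_path :: "step list \<Rightarrow> nat list" where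
  "list_of_path w = concat (map2 replicate (map step_mult w) [1..<length w + 1])"

lemma map_mult_list_of_path:
  "map (mult (list_of_path w)) [1..<length w + 1] = map step_mult w"
  unfolding list_of_path_def mult_eq_count_list
  by (rule map_count_list_concat_map2_replicate) (simp_all del: upt_Suc)

lemma set_list_of_path: "set (list_of_path w) \<subseteq> {1..length w}"
proof
  fix j assume "j \<in> set (list_of_path w)"
  then have "j \<in> set [1..<length w + 1]"
    unfolding list_of_path_def by (rule in_set_concat_map2_replicateD)
  then show "j \<in> {1..length w}" by (simp del: upt_Suc)
qed

lemma length_list_of_path: "length (list_of_path w) = sum_list (map step_mult w)"
proof -
  have "length (list_of_path w) = sum (mult (list_of_path w)) {1..length w}"
    by (simp only: mult_eq_count_list sum_count_set set_list_of_path finite_atLeastAtMost)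
  also have "\<dots> = sum_list (map (mult (list_of_path w)) [1..<length w + 1])"
    by (simp add: interv_sum_list_conv_sum_set_nat atLeastLessThanSuc_atLeastAtMost del: upt_Suc)
  finally show ?thesis by (simp only: map_mult_list_of_path)
qed

lemma mult_list_of_path_le_2: "\<forall>j\<in>{1..length w}. mult (list_of_path w) j \<le> 2"
proof
  fix j assume "j \<in> {1..length w}"
  then have "mult (list_of_path w) j \<in> set (map (mult (list_of_path w)) [1..<length w + 1])"
    by (simp del: upt_Suc)
  then show "mult (list_of_path w) j \<le> 2"
    by (auto simp only: map_mult_list_of_path set_map step_mult_le_2)
qed

lemma Phi_list_of_path: "Phi (length w) (list_of_path w) = w"
proof -
  have "map step_mult (Phi (length w) (list_of_path w)) = map step_mult w"
    by (simp only: map_step_mult_Phi[OF mult_list_of_path_le_2] map_mult_list_of_path)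
  then show ?thesis
    using inj_step_mult by (simp add: inj_map_eq_map)
qed

lemma list_of_path_in_MotzPF:
  assumes "w \<in> Motz n"
  shows "list_of_path w \<in> MotzPF n"
proof -
  have length: "length w = n" and "sum_list (map step_mult w) = n"
    using assms by (simp_all add: Motz_iff)
  then have "list_of_path w \<in> tuples n"
    using set_list_of_path[of w] by (simp add: tuples_def length_list_of_path)
  moreover have "\<forall>j\<in>{1..n}. mult (list_of_path w) j \<le> 2"
    using mult_list_of_path_le_2[of w] by (simp only: length)
  moreover have "Phi n (list_of_path w) = w"
    using Phi_list_of_path[of w] by (simp only: length)
  ultimately show ?thesis
    using assms by (simp add: MotzPF_iff)
qed

lemma Phi_image_MotzPF: "Phi n ` MotzPF n = Motz n"
proof
  show "Phi n ` MotzPF n \<subseteq> Motz n"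
    by (auto simp: MotzPF_iff)
  show "Motz n \<subseteq> Phi n ` MotzPF n"
  proof
    fix w assume "w \<in> Motz n"
    then have "length w = n" "list_of_path w \<in> MotzPF n"
      by (simp_all add: Motz_iff list_of_path_in_MotzPF)
    then show "w \<in> Phi n ` MotzPF n"
      using Phi_list_of_path[of w] by (metis imageI)
  qed
qed

theorem theorem3p4:
  fixes n :: nat
  shows "(Phi n) respects (perm_rel n) \<and>
         bij_betw (induced (Phi n)) (MotzPF n // perm_rel n) (Motz n)"
proof
  show "(Phi n) respects (perm_rel n)"
    by (rule Phi_respects_perm_rel)
  have "(p, q) \<in> perm_rel n" if "p \<in> MotzPF n" "q \<in> MotzPF n" "Phi n p = Phi n q" for p q
    unfolding perm_rel_iff_mset using that by (blast intro: mset_eq_if_Phi_eq)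
  with equiv_perm_rel Phi_respects_perm_rel
  have "bij_betw (induced (Phi n)) (MotzPF n // perm_rel n) (Phi n ` MotzPF n)"
    by (rule bij_betw_induced)
  then show "bij_betw (induced (Phi n)) (MotzPF n // perm_rel n) (Motz n)"
    by (simp only: Phi_image_MotzPF)
qed

end
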